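(* Let $F \colon \mathbb{R}^n \times \mathbb{R}^m \to \mathbb{R}^n$ be $C^1$, let $0 \leq \rho < 1$, and let $\mathcal{X} \subset \mathbb{R}^n$ be nonempty, convex and closed, such that for every $\theta \in \mathbb{R}^m$ one has $F_\theta(\mathcal{X}) \subset \mathcal{X}$ and $\|J_x F(x,\theta)\|_{\mathrm{op}} \leq \rho$ for all $x \in \mathcal{X}$. Assume moreover that for every $x \in \mathbb{R}^n$ the map $\theta \mapsto F(x,\theta)$ is $L_F$-Lipschitz, and for every $\theta \in \mathbb{R}^m$ the map $x \mapsto J_\theta F(x,\theta)$ is $L_J$-Lipschitz on $\mathbb{R}^n$ (in operator norm). Consider the bilevel problem $$\min_\theta\ g(x(\theta)) \quad \text{s.t.} \quad x(\theta) = F(x(\theta),\theta),$$ where $g \colon \mathbb{R}^n \to \mathbb{R}$ is $C^1$, $l_g$-Lipschitz, with $l_\nabla$-Lipschitz gradient. Then, for all $\theta \in \mathbb{R}^m$ and all $k \geq 1$, $$\left\| \nabla_\theta (g \circ \bar{x})(\theta) - J^{\mathrm{OS}} x_k(\theta)^T \nabla g(x_k(\theta)) \right\| \leq \frac{\rho L_F l_g}{1 - \rho} + L_J l_g \|x_{k-1}(\theta) - \bar{x}(\theta)\| + L_F l_\nabla \|\bar{x}(\theta) - x_k(\theta)\|.$$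
   Context: Write $F_\theta \colon x \mapsto F(x,\theta)$. $J_x F(x,\theta) \in \mathbb{R}^{n\times n}$ and $J_\theta F(x,\theta) \in \mathbb{R}^{n \times m}$ denote the partial Jacobian matrices of $F$ with respect to its first and second variable. $\|\cdot\|$ is the Euclidean norm and $\|\cdot\|_{\mathrm{op}}$ the induced operator norm. The iterates are defined by $x_0(\theta) \in \mathbb{R}^n$ and $x_{k+1}(\theta) = F(x_k(\theta),\theta)$ for $k \geq 0$. Under the stated hypotheses on $F$ and $\mathcal{X}$, for each $\theta \in \mathbb{R}^m$ the map $F_\theta$ has a unique fixed point in $\mathcal{X}$, denoted $\bar{x}(\theta)$ (this is the $x(\theta)$ of the bilevel problem), and $\theta \mapsto \bar{x}(\theta)$ is $C^1$. The one-step estimator is defined, for $k \geq 1$, as $J^{\mathrm{OS}} x_k(\theta) := J_\theta F(x_{k-1}(\theta), \theta)$, i.e. the partial Jacobian of $F$ in its second variable evaluated at the point $(x_{k-1}(\theta),\theta)$ (the dependence of $x_{k-1}$ on $\theta$ is not differentiated). *)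

theory Defs
  imports "HOL-Analysis.Analysis"
begin

definition C1 :: "('a::real_normed_vector \<Rightarrow> 'b::real_normed_vector) \<Rightarrow> bool" where
  "C1 f \<longleftrightarrow> (\<exists>f'. (\<forall>x. (f has_derivative blinfun_apply (f' x)) (at x)) \<and> continuous_on UNIV f')"

definition gradient :: "('a::real_inner \<Rightarrow> real) \<Rightarrow> 'a \<Rightarrow> 'a" where
  "gradient f x = (THE D. GDERIV f x :> D)"

lemma gradient_eqI:
  assumes "GDERIV f x :> D"
  shows "gradient f x = D"
  unfolding gradient_def
proof (rule the_equality)
  fix D' assume "GDERIV f x :> D'"
  then have "(\<lambda>h. inner h D') = (\<lambda>h. inner h D)"
    using assms has_derivative_unique unfolding gderiv_def by blast
  then show "D' = D"
    by (metis vector_eq_ldot)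
qed (fact assms)

text \<open>The operator norm of a matrix induced by the Euclidean norms. The \<open>norm\<close> of the type
  of matrices is the Frobenius norm, so it (and \<open>lipschitz_on\<close>) cannot be used instead.\<close>

definition op_norm :: "real^'n^'m \<Rightarrow> real" where
  "op_norm A = onorm (\<lambda>v. A *v v)"

definition jac_x :: "((real^'n) \<times> (real^'m) \<Rightarrow> real^'n) \<Rightarrow> real^'n \<Rightarrow> real^'m \<Rightarrow> real^'n^'n" where
  "jac_x F x \<theta> = jacobian (\<lambda>y. F (y, \<theta>)) (at x)"

definition jac_theta :: "((real^'n) \<times> (real^'m) \<Rightarrow> real^'n) \<Rightarrow> real^'n \<Rightarrow> real^'m \<Rightarrow> real^'m^'n" where
  "jac_theta F x \<theta> = jacobian (\<lambda>t. F (x, t)) (at \<theta>)"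

primrec iter :: "('a \<times> 'b \<Rightarrow> 'a) \<Rightarrow> ('b \<Rightarrow> 'a) \<Rightarrow> nat \<Rightarrow> 'b \<Rightarrow> 'a" where
  "iter F x0 0 \<theta> = x0 \<theta>"
| "iter F x0 (Suc k) \<theta> = F (iter F x0 k \<theta>, \<theta>)"

text \<open>Only meaningful for \<open>k \<ge> 1\<close>.\<close>

definition one_step ::
  "((real^'n) \<times> (real^'m) \<Rightarrow> real^'n) \<Rightarrow> (real^'m \<Rightarrow> real^'n) \<Rightarrow> nat \<Rightarrow> real^'m \<Rightarrow> real^'m^'n" where
  "one_step F x0 k \<theta> = jac_theta F (iter F x0 (k - 1) \<theta>) \<theta>"

definition fixpt :: "('a \<times> 'b \<Rightarrow> 'a) \<Rightarrow> 'a set \<Rightarrow> 'b \<Rightarrow> 'a" where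
  "fixpt F X \<theta> = (THE x. x \<in> X \<and> x = F (x, \<theta>))"

lemma fixpt_unique:
  fixes F :: "(real^'n) \<times> (real^'m) \<Rightarrow> real^'n"
  assumes "C1 F" "0 \<le> \<rho>" "\<rho> < 1" "X \<noteq> {}" "convex X" "closed X"
    and self: "(\<lambda>x. F (x, \<theta>)) ` X \<subseteq> X"
    and bound: "\<And>x. x \<in> X \<Longrightarrow> op_norm (jac_x F x \<theta>) \<le> \<rho>"
  shows "\<exists>!x. x \<in> X \<and> x = F (x, \<theta>)"
proof -
  have diff: "(\<lambda>y. F (y, \<theta>)) differentiable (at x)" for x
  proof -
    obtain D where "(F has_derivative D) (at (x, \<theta>))"
      using \<open>C1 F\<close> unfolding C1_def by blast
    moreover have "((\<lambda>y. (y, \<theta>)) has_derivative (\<lambda>h. (h, 0))) (at x)"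
      by (auto intro!: derivative_eq_intros)
    ultimately show ?thesis
      unfolding differentiable_def using has_derivative_compose by blast
  qed
  have "((\<lambda>y. F (y, \<theta>)) has_derivative (\<lambda>h. jac_x F x \<theta> *v h)) (at x within X)" for x
    using diff[of x] unfolding jac_x_def
    by (simp add: jacobian_works[symmetric] has_derivative_at_withinI)
  then have "dist (F (x, \<theta>)) (F (y, \<theta>)) \<le> \<rho> * dist x y" if "x \<in> X" "y \<in> X" for x y
    unfolding dist_norm
    using differentiable_bound[OF \<open>convex X\<close>, of "\<lambda>y. F (y, \<theta>)" "\<lambda>x h. jac_x F x \<theta> *v h"]
      bound that by (simp add: op_norm_def)
  then have "\<exists>!x\<in>X. F (x, \<theta>) = x"
    using Banach_fix[of X \<rho> "\<lambda>x. F (x, \<theta>)"] assms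
    by (simp add: complete_eq_closed)
  then show ?thesis
    by metis
qed

end

theory Submission
  imports Defs
begin

text \<open>Only differentiability of \<open>F\<close> at the fixed point is needed for that of \<open>\<theta> \<mapsto> x\<^sub>\<theta>\<close>:
  the contraction estimate makes \<open>\<theta> \<mapsto> x\<^sub>\<theta>\<close> Lipschitz, so the first-order expansion of \<open>F\<close>
  along \<open>(x\<^sub>\<theta>, \<theta>)\<close> has an \<open>o(\<bar>\<Delta>\<theta>\<bar>)\<close> remainder, and inverting \<open>I - A\<close>, with \<open>A\<close> and \<open>B\<close> the
  partial Jacobians, gives a derivative \<open>D\<close> with \<open>D = A D + B\<close>. Hence \<open>\<bar>D\<bar> \<le> L\<^sub>F / (1 - \<rho>)\<close> and
  \<open>\<bar>D - B\<bar> = \<bar>A D\<bar> \<le> \<rho> L\<^sub>F / (1 - \<rho>)\<close>; with \<open>B\<^sub>k\<close> the one-step estimator and \<open>G\<close>, \<open>G\<^sub>k\<close>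
  the gradients of \<open>g\<close> at the fixed point and at the \<open>k\<close>-th iterate, the claim follows from the
  splitting \<open>D\<^sup>T G - B\<^sub>k\<^sup>T G\<^sub>k = (D - B)\<^sup>T G + (B - B\<^sub>k)\<^sup>T G + B\<^sub>k\<^sup>T (G - G\<^sub>k)\<close>.\<close>

text \<open>For small \<open>t > 0\<close> the increment \<open>f (x + t *\<^sub>R v) - f x\<close>
  has norm at most \<open>L * t * norm v\<close> and differs from \<open>t *\<^sub>R f' v\<close> by
  an arbitrarily small multiple of \<open>t * norm v\<close>; divide by \<open>t\<close>.\<close>

lemma has_derivative_lipschitz_bound:
  assumes f: "(f has_derivative f') (at x)" and lip: "L-lipschitz_on UNIV f"
  shows "norm (f' v) \<le> L * norm v"
proof (rule field_le_epsilon)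
  fix e :: real assume e: "e > 0"
  \<comment> \<open>Chosen so that \<open>c * norm v \<le> e\<close>; the added 1 avoids division by
    zero when \<open>v = 0\<close>.\<close>
  define c where "c = e / (norm v + 1)"
  have c: "c > 0" using e by (simp add: c_def add_nonneg_pos)
  have lin: "linear f'" using f by (rule has_derivative_linear)
  obtain d where d: "d > 0" "\<And>y. norm (y - x) < d \<Longrightarrow> norm (f y - f x - f' (y - x)) \<le> c * norm (y - x)"
    using f c unfolding has_derivative_at_alt by blast
  define t where "t = d / (2 * (norm v + 1))"
  have t: "t > 0" "t * norm v < d"
    using d(1) norm_ge_zero[of v] by (auto simp: t_def field_simps add_nonneg_pos add_pos_nonneg)
  have "norm (f (x + t *\<^sub>R v) - f x - f' (t *\<^sub>R v)) \<le> c * norm (t *\<^sub>R v)"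
    using d(2)[of "x + t *\<^sub>R v"] t by simp
  moreover have "norm (f (x + t *\<^sub>R v) - f x) \<le> L * norm (t *\<^sub>R v)"
    using lipschitz_onD[OF lip, of "x + t *\<^sub>R v" x] by (simp add: dist_norm)
  ultimately have "norm (f' (t *\<^sub>R v)) \<le> (L + c) * norm (t *\<^sub>R v)"
    using norm_triangle_sub[of "f' (t *\<^sub>R v)" "f (x + t *\<^sub>R v) - f x"]
    by (simp add: norm_minus_commute algebra_simps)
  then have "t * norm (f' v) \<le> t * ((L + c) * norm v)"
    using t by (simp add: linear_cmul[OF lin] algebra_simps)
  then have "norm (f' v) \<le> (L + c) * norm v" using t by simp
  moreover have "c * norm v \<le> e"
    using e by (simp add: c_def field_simps add_nonneg_pos add_pos_nonneg)
  ultimately show "norm (f' v) \<le> L * norm v + e" by (simp add: algebra_simps)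
qed

text \<open>The Riesz vector of the functional \<open>f'\<close> is its adjoint applied to 1, and
  uniqueness of gradients identifies it with \<open>gradient f x\<close>.\<close>

lemma inner_gradient:
  fixes f :: "'a::euclidean_space \<Rightarrow> real"
  assumes f: "(f has_derivative f') (at x)"
  shows "v \<bullet> gradient f x = f' v"
proof -
  have *: "h \<bullet> adjoint f' 1 = f' h" for h
    using adjoint_works[OF has_derivative_linear[OF f], of h 1] by simp
  have "GDERIV f x :> adjoint f' 1"
    unfolding gderiv_def * using f by (simp add: eta_contract_eq)
  then show ?thesis by (simp add: gradient_eqI *)
qed

text \<open>Test with \<open>v = u\<close>. Estimates on gradients thereby reduce to estimates on
  directional derivatives.\<close>

lemma norm_le_inner_bound:
  fixes u :: "'a::euclidean_space"
  assumes "\<And>v. v \<bullet> u \<le> c * norm v"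
  shows "norm u \<le> c"
proof (cases "u = 0")
  case True
  \<comment> \<open>For \<open>u = 0\<close> the claim is \<open>0 \<le> c\<close>, which a unit
    vector reveals.\<close>
  obtain v :: 'a where "norm v = 1" using vector_choose_size[of 1] by auto
  then show ?thesis using assms[of v] True by simp
next
  case False
  then show ?thesis using assms[of u] by (simp add: dot_square_norm power2_eq_square)
qed

lemma norm_matrix_vector_le:
  fixes A :: "real^'n^'m"
  assumes "op_norm A \<le> c"
  shows "norm (A *v v) \<le> c * norm v"
proof -
  have "norm (A *v v) \<le> op_norm A * norm v"
    unfolding op_norm_def by (rule onorm) (rule matrix_vector_mul_bounded_linear)
  also have "\<dots> \<le> c * norm v" using assms by (rule mult_right_mono) simp
  finally show ?thesis .
qed

text \<open>Composing \<open>F\<close> with the embeddings \<open>y \<mapsto> (y, \<theta>)\<close>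
  and \<open>t \<mapsto> (x, t)\<close> gives the derivatives \<open>F' (h, 0)\<close> and
  \<open>F' (0, k)\<close>; uniqueness of derivatives matches them with the Jacobian
  matrices.\<close>

lemma partial_jacobians:
  fixes F :: "(real^'n) \<times> (real^'m) \<Rightarrow> real^'n"
  assumes F: "(F has_derivative F') (at (x, \<theta>))"
  shows "((\<lambda>y. F (y, \<theta>)) has_derivative (\<lambda>h. jac_x F x \<theta> *v h)) (at x)"
    and "((\<lambda>t. F (x, t)) has_derivative (\<lambda>h. jac_theta F x \<theta> *v h)) (at \<theta>)"
    and "F' (h, k) = jac_x F x \<theta> *v h + jac_theta F x \<theta> *v k"
proof -
  have 1: "((\<lambda>y. F (y, \<theta>)) has_derivative (\<lambda>h. F' (h, 0))) (at x)"
    by (rule has_derivative_compose[of "\<lambda>y. (y, \<theta>)", OF _ F]) (auto intro!: derivative_eq_intros)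
  have 2: "((\<lambda>t. F (x, t)) has_derivative (\<lambda>k. F' (0, k))) (at \<theta>)"
    by (rule has_derivative_compose[of "\<lambda>t. (x, t)", OF _ F]) (auto intro!: derivative_eq_intros)
  show 3: "((\<lambda>y. F (y, \<theta>)) has_derivative (\<lambda>h. jac_x F x \<theta> *v h)) (at x)"
    using 1 jacobian_works unfolding jac_x_def differentiable_def by blast
  show 4: "((\<lambda>t. F (x, t)) has_derivative (\<lambda>h. jac_theta F x \<theta> *v h)) (at \<theta>)"
    using 2 jacobian_works unfolding jac_theta_def differentiable_def by blast
  have "F' (h, k) = F' (h, 0) + F' (0, k)"
    using linear_add[OF has_derivative_linear[OF F], of "(h, 0)" "(0, k)"] by simp
  then show "F' (h, k) = jac_x F x \<theta> *v h + jac_theta F x \<theta> *v k"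
    using fun_cong[OF has_derivative_unique[OF 1 3], of h]
      fun_cong[OF has_derivative_unique[OF 2 4], of k] by simp
qed

lemma has_derivative_fixed_point:
  fixes F :: "'a::euclidean_space \<times> 'b::real_normed_vector \<Rightarrow> 'a"
  assumes F: "(F has_derivative F') (at (\<xi> \<theta>, \<theta>))"
    and fixed: "\<And>t. \<xi> t = F (\<xi> t, t)"
    and lip: "C-lipschitz_on UNIV \<xi>"
    and contr: "\<And>h. norm (F' (h, 0)) \<le> \<rho> * norm h" and \<rho>: "\<rho> < 1"
  obtains D where "(\<xi> has_derivative D) (at \<theta>)" "\<And>v. D v = F' (D v, v)"
proof -
  have linF: "linear F'" and blF: "bounded_linear F'"
    using F by (auto intro: has_derivative_linear has_derivative_bounded_linear)
  have split: "F' (h, k) = F' (h, 0) + F' (0, k)" for h k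
    using linear_add[OF linF, of "(h, 0)" "(0, k)"] by simp
  define T where "T h = h - F' (h, 0)" for h
  have linT: "linear T"
  proof
    show "T (a + b) = T a + T b" for a b
      using linear_add[OF linF, of "(a, 0)" "(b, 0)"] by (simp add: T_def)
    show "T (r *\<^sub>R a) = r *\<^sub>R T a" for r a
      using linear_scale[OF linF, of r "(a, 0)"] by (simp add: T_def scaleR_diff_right)
  qed
  \<comment> \<open>Being bounded below, \<open>T\<close> is injective, hence invertible in finite
    dimension; the same bound later turns an estimate on \<open>T\<close> of the error into one on
    the error.\<close>
  have lower: "(1 - \<rho>) * norm h \<le> norm (T h)" for h
    using contr[of h] norm_triangle_ineq2[of h "F' (h, 0)"] by (simp add: T_def algebra_simps)
  have "h = 0" if "T h = 0" for h
    using lower[of h] \<rho> that by (simp add: mult_le_0_iff)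
  then have "inj T" using linT by (simp add: linear_injective_0)
  then obtain M where M: "linear M" "\<And>h. T (M h) = h"
    using linear_injective_isomorphism[OF linT] by blast
  define D where "D v = M (F' (0, v))" for v
  have D: "D v = F' (D v, v)" for v
    using M(2)[of "F' (0, v)"] split[of "D v" v] by (simp add: D_def T_def algebra_simps)
  have blD: "bounded_linear D"
    unfolding D_def
    by (intro bounded_linear_compose[OF linear_conv_bounded_linear[THEN iffD1, OF M(1)]]
        bounded_linear_compose[OF blF] bounded_linear_Pair bounded_linear_zero bounded_linear_ident)
  have C: "C \<ge> 0" using lip by (rule lipschitz_on_nonneg)
  have "(\<xi> has_derivative D) (at \<theta>)"
    unfolding has_derivative_at_alt
  proof (intro conjI allI impI blD)
    fix e :: real assume e: "e > 0"
    \<comment> \<open>The factor \<open>C + 1\<close> is a Lipschitz constant of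
      \<open>t \<mapsto> (\<xi> t, t)\<close>, and \<open>1 - \<rho>\<close> pays for undoing
      \<open>T\<close>.\<close>
    define c where "c = e * (1 - \<rho>) / (C + 1)"
    have c: "c > 0" using e \<rho> C by (simp add: c_def)
    obtain d where d: "d > 0" "\<And>y. norm (y - (\<xi> \<theta>, \<theta>)) < d \<Longrightarrow>
        norm (F y - F (\<xi> \<theta>, \<theta>) - F' (y - (\<xi> \<theta>, \<theta>))) \<le> c * norm (y - (\<xi> \<theta>, \<theta>))"
      using F c unfolding has_derivative_at_alt by blast
    have "norm (\<xi> t - \<xi> \<theta> - D (t - \<theta>)) \<le> e * norm (t - \<theta>)" if t: "norm (t - \<theta>) < d / (C + 1)" for t
    proof -
      let ?w = "(\<xi> t - \<xi> \<theta>, t - \<theta>)"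
      have "norm (\<xi> t - \<xi> \<theta>) \<le> C * norm (t - \<theta>)"
        using lipschitz_onD[OF lip, of t \<theta>] by (simp add: dist_norm)
      then have w: "norm ?w \<le> (C + 1) * norm (t - \<theta>)"
        using norm_Pair_le[of "\<xi> t - \<xi> \<theta>" "t - \<theta>"] by (simp add: algebra_simps)
      also have "\<dots> < d" using t C by (simp add: field_simps)
      finally have "norm (\<xi> t - \<xi> \<theta> - F' ?w) \<le> c * norm ?w"
        using d(2)[of "(\<xi> t, t)"] fixed[symmetric] by simp
      also have "\<dots> \<le> c * ((C + 1) * norm (t - \<theta>))" using w c by simp
      also have "\<dots> = (1 - \<rho>) * (e * norm (t - \<theta>))" using C by (simp add: c_def field_simps)
      finally have "norm (\<xi> t - \<xi> \<theta> - F' ?w) \<le> (1 - \<rho>) * (e * norm (t - \<theta>))" .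
      \<comment> \<open>\<open>T (D v) = F' (0, v)\<close>, so \<open>T\<close> maps the error of
        \<open>D\<close> to the remainder of \<open>F\<close> along the fixed points.\<close>
      moreover have "T (\<xi> t - \<xi> \<theta> - D (t - \<theta>)) = \<xi> t - \<xi> \<theta> - F' ?w"
        unfolding linear_diff[OF linT, of "\<xi> t - \<xi> \<theta>" "D (t - \<theta>)"]
        using D[of "t - \<theta>"] split[of "D (t - \<theta>)" "t - \<theta>"] split[of "\<xi> t - \<xi> \<theta>" "t - \<theta>"]
        by (simp add: T_def algebra_simps)
      ultimately have "(1 - \<rho>) * norm (\<xi> t - \<xi> \<theta> - D (t - \<theta>)) \<le> (1 - \<rho>) * (e * norm (t - \<theta>))"
        using lower[of "\<xi> t - \<xi> \<theta> - D (t - \<theta>)"] by simp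
      then show ?thesis using \<rho> by simp
    qed
    then show "\<exists>d>0. \<forall>t. norm (t - \<theta>) < d \<longrightarrow> norm (\<xi> t - \<xi> \<theta> - D (t - \<theta>)) \<le> e * norm (t - \<theta>)"
      using d(1) C by (intro exI[of _ "d / (C + 1)"]) simp
  qed
  then show ?thesis using D by (rule that)
qed

lemma C1_has_derivative:
  assumes "C1 f"
  obtains f' where "\<And>x. (f has_derivative f' x) (at x)"
proof -
  obtain d where "\<forall>x. (f has_derivative blinfun_apply (d x)) (at x)"
    using assms unfolding C1_def by blast
  then show ?thesis by (intro that[of "\<lambda>x. blinfun_apply (d x)"]) blast
qed

theorem corollary4:
  fixes F :: "(real^'n) \<times> (real^'m) \<Rightarrow> real^'n"
    and X :: "(real^'n) set"
    and g :: "real^'n \<Rightarrow> real"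
    and x0 :: "real^'m \<Rightarrow> real^'n"
    and \<rho> L_F L_J l_g l_nabla :: real
  assumes "C1 F"
    and "0 \<le> \<rho>" and "\<rho> < 1"
    and "X \<noteq> {}" and "convex X" and "closed X"
    and "\<And>\<theta>. (\<lambda>x. F (x, \<theta>)) ` X \<subseteq> X"
    and "\<And>\<theta> x. x \<in> X \<Longrightarrow> op_norm (jac_x F x \<theta>) \<le> \<rho>"
    and "\<And>x. L_F-lipschitz_on UNIV (\<lambda>\<theta>. F (x, \<theta>))"
    and "\<And>\<theta> x y. op_norm (jac_theta F x \<theta> - jac_theta F y \<theta>) \<le> L_J * norm (x - y)"
    and "C1 g"
    and "l_g-lipschitz_on UNIV g"
    and "l_nabla-lipschitz_on UNIV (gradient g)"
  shows "\<forall>\<theta>. \<forall>k\<ge>1.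
    norm (gradient (g \<circ> fixpt F X) \<theta>
          - transpose (one_step F x0 k \<theta>) *v gradient g (iter F x0 k \<theta>))
    \<le> \<rho> * L_F * l_g / (1 - \<rho>)
      + L_J * l_g * norm (iter F x0 (k - 1) \<theta> - fixpt F X \<theta>)
      + L_F * l_nabla * norm (fixpt F X \<theta> - iter F x0 k \<theta>)"
proof (intro allI impI)
  fix \<theta> :: "real^'m" and k :: nat
  define \<xi> where "\<xi> = fixpt F X"
  obtain F' where F': "(F has_derivative F' p) (at p)" for p
    by (rule C1_has_derivative[OF \<open>C1 F\<close>]) (rule that)
  obtain g' where g': "(g has_derivative g' p) (at p)" for p
    by (rule C1_has_derivative[OF \<open>C1 g\<close>]) (rule that)
  have Jx: "((\<lambda>y. F (y, t)) has_derivative (\<lambda>h. jac_x F x t *v h)) (at x)"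
    and Jt: "((\<lambda>t. F (x, t)) has_derivative (\<lambda>h. jac_theta F x t *v h)) (at t)"
    and F'_eq: "F' (x, t) (h, v) = jac_x F x t *v h + jac_theta F x t *v v" for x t h v
    using partial_jacobians[OF F'] by blast+
  have "\<xi> t \<in> X \<and> \<xi> t = F (\<xi> t, t)" for t
    unfolding \<xi>_def fixpt_def by (rule theI'[OF fixpt_unique[OF assms(1-8)]])
  then have \<xi>X: "\<xi> t \<in> X" and \<xi>: "\<xi> t = F (\<xi> t, t)" for t by blast+
  have LF: "0 \<le> L_F" using assms(9) by (rule lipschitz_on_nonneg)
  \<comment> \<open>Mean value inequality, available because \<open>X\<close> is convex.\<close>
  have contr: "norm (F (x, t) - F (y, t)) \<le> \<rho> * norm (x - y)" if "x \<in> X" "y \<in> X" for x y t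
    using differentiable_bound[OF \<open>convex X\<close>, of "\<lambda>y. F (y, t)" "\<lambda>x h. jac_x F x t *v h"]
      has_derivative_at_withinI[OF Jx] assms(8) that by (simp add: op_norm_def)
  have "norm (\<xi> s - \<xi> t) \<le> L_F / (1 - \<rho>) * norm (s - t)" for s t
  proof -
    \<comment> \<open>Insert \<open>F (\<xi> t, s)\<close>: one difference contracts, the other is
      Lipschitz in the parameter, and the term with \<open>\<rho>\<close> is absorbed on the
      left.\<close>
    have "norm (\<xi> s - \<xi> t) = norm ((F (\<xi> s, s) - F (\<xi> t, s)) + (F (\<xi> t, s) - F (\<xi> t, t)))"
      using \<xi>[of s] \<xi>[of t] by simp
    also have "\<dots> \<le> \<rho> * norm (\<xi> s - \<xi> t) + L_F * norm (s - t)"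
      using contr[OF \<xi>X \<xi>X] lipschitz_onD[OF assms(9), of s t]
      by (intro norm_triangle_le add_mono) (auto simp: dist_norm)
    finally show ?thesis using \<open>\<rho> < 1\<close> by (simp add: field_simps)
  qed
  then have lip: "(L_F / (1 - \<rho>))-lipschitz_on UNIV \<xi>"
    using LF \<open>\<rho> < 1\<close> by (intro lipschitz_onI) (auto simp: dist_norm)
  define A where "A = jac_x F (\<xi> \<theta>) \<theta>"
  define B where "B = jac_theta F (\<xi> \<theta>) \<theta>"
  define Bk where "Bk = one_step F x0 k \<theta>"
  define G where "G = gradient g (\<xi> \<theta>)"
  define Gk where "Gk = gradient g (iter F x0 k \<theta>)"
  have A: "norm (A *v h) \<le> \<rho> * norm h" for h
    unfolding A_def using assms(8)[OF \<xi>X] by (rule norm_matrix_vector_le)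
  obtain D where D': "(\<xi> has_derivative D) (at \<theta>)" and D: "\<And>v. D v = A *v D v + B *v v"
  proof (rule has_derivative_fixed_point[where \<xi>=\<xi>, OF F' \<xi> lip _ \<open>\<rho> < 1\<close>])
    show "norm (F' (\<xi> \<theta>, \<theta>) (h, 0)) \<le> \<rho> * norm h" for h
      using A[of h] by (simp add: F'_eq A_def)
  qed (auto simp: F'_eq A_def B_def)
  \<comment> \<open>Stated at every \<open>x\<close>, since the iterates may lie outside
    \<open>X\<close>.\<close>
  have Bv: "norm (jac_theta F x t *v v) \<le> L_F * norm v" for x t v
    using Jt assms(9) by (rule has_derivative_lipschitz_bound)
  have Dv: "norm (D v) \<le> L_F / (1 - \<rho>) * norm v" for v
    using D' lip by (rule has_derivative_lipschitz_bound)
  have G: "norm G \<le> l_g"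
    unfolding G_def
  proof (rule norm_le_inner_bound)
    show "v \<bullet> gradient g (\<xi> \<theta>) \<le> l_g * norm v" for v
      using has_derivative_lipschitz_bound[OF g' assms(12), of "\<xi> \<theta>" v]
      by (simp add: inner_gradient[OF g'])
  qed
  have inner_le: "a \<bullet> b \<le> r * s" if "norm a \<le> r" "norm b \<le> s" for a b :: "real^'n" and r s
    using norm_cauchy_schwarz[of a b] mult_mono'[OF that] by simp
  have "norm (gradient (g \<circ> \<xi>) \<theta> - transpose Bk *v Gk)
      \<le> \<rho> * L_F * l_g / (1 - \<rho>) + L_J * l_g * norm (iter F x0 (k - 1) \<theta> - \<xi> \<theta>)
        + L_F * l_nabla * norm (\<xi> \<theta> - iter F x0 k \<theta>)" (is "_ \<le> ?c1 + ?c2 + ?c3")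
  proof (rule norm_le_inner_bound)
    fix v :: "real^'m"
    \<comment> \<open>Pairing with \<open>v\<close> moves the transpose onto \<open>v\<close>, and
      the chain rule gives the derivative of \<open>g \<circ> \<xi>\<close> as
      \<open>D v \<bullet> G\<close>.\<close>
    have "v \<bullet> (gradient (g \<circ> \<xi>) \<theta> - transpose Bk *v Gk) = D v \<bullet> G - (Bk *v v) \<bullet> Gk"
      using inner_gradient[OF diff_chain_at[OF D' g'], of v] inner_gradient[OF g', of "D v" "\<xi> \<theta>"]
        dot_lmul_matrix[of Gk Bk v]
      by (simp add: G_def inner_diff_right inner_commute)
    \<comment> \<open>Substitute \<open>D v = A *v D v + B *v v\<close>, then add and subtract
      \<open>(Bk *v v) \<bullet> G\<close>.\<close>
    also have "\<dots> = (A *v D v) \<bullet> G + ((B - Bk) *v v) \<bullet> G + (Bk *v v) \<bullet> (G - Gk)"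
      using arg_cong[OF D[of v], of "\<lambda>a. a \<bullet> G"]
      by (simp add: inner_diff inner_add matrix_vector_mult_diff_rdistrib algebra_simps)
    also have "\<dots> \<le> ?c1 * norm v + ?c2 * norm v + ?c3 * norm v"
    proof (intro add_mono)
      have "norm (A *v D v) \<le> \<rho> * (L_F / (1 - \<rho>) * norm v)"
        using A[of "D v"] mult_left_mono[OF Dv[of v] \<open>0 \<le> \<rho>\<close>] by simp
      from inner_le[OF this G] show "(A *v D v) \<bullet> G \<le> ?c1 * norm v"
        by (simp add: mult_ac)
      \<comment> \<open>\<open>Bk\<close> is evaluated at iterate \<open>k - 1\<close>, whereas
        \<open>Gk\<close> belongs to iterate \<open>k\<close>; hence the two different distances in
        the bound.\<close>
      have "norm ((B - Bk) *v v) \<le> L_J * norm (iter F x0 (k - 1) \<theta> - \<xi> \<theta>) * norm v"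
        unfolding B_def Bk_def one_step_def
        using assms(10)[of "\<xi> \<theta>" \<theta> "iter F x0 (k - 1) \<theta>"]
        by (intro norm_matrix_vector_le) (simp add: norm_minus_commute)
      from inner_le[OF this G] show "((B - Bk) *v v) \<bullet> G \<le> ?c2 * norm v"
        by (simp add: mult_ac)
      have "norm (Bk *v v) \<le> L_F * norm v"
        unfolding Bk_def one_step_def by (rule Bv)
      moreover have "norm (G - Gk) \<le> l_nabla * norm (\<xi> \<theta> - iter F x0 k \<theta>)"
        using lipschitz_onD[OF assms(13)] by (simp add: G_def Gk_def dist_norm)
      ultimately show "(Bk *v v) \<bullet> (G - Gk) \<le> ?c3 * norm v"
        by (auto dest: inner_le simp: mult_ac)
    qed
    finally show "v \<bullet> (gradient (g \<circ> \<xi>) \<theta> - transpose Bk *v Gk) \<le> (?c1 + ?c2 + ?c3) * norm v"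
      by (simp add: distrib_right)
  qed
  then show "norm (gradient (g \<circ> fixpt F X) \<theta>
          - transpose (one_step F x0 k \<theta>) *v gradient g (iter F x0 k \<theta>))
    \<le> \<rho> * L_F * l_g / (1 - \<rho>)
      + L_J * l_g * norm (iter F x0 (k - 1) \<theta> - fixpt F X \<theta>)
      + L_F * l_nabla * norm (fixpt F X \<theta> - iter F x0 k \<theta>)"
    by (simp add: \<xi>_def Bk_def Gk_def)
qed

end
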